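(* Let $f:\mathbb{R}^2\to\mathbb{R}$ and let $Y_i=f(X_{i,1},X_{i,2})+\varepsilon_i$, $i=1,\dots,N$, where the predictor values $(X_{i,1},X_{i,2})\in\mathbb{R}^2$ are fixed (nonrandom) and the errors $\varepsilon_i$ are independent identically distributed random variables with mean $0$ and variance $\sigma_\varepsilon^2$. Let $\hat f_w$ be the wQISA estimator built from the data $(X_{i,1},X_{i,2},Y_i)$, $i=1,\dots,N$, with respect to a tensor product spline space and a family of weight functions. Then, for every (nonrandom) point $(X_1,X_2)\in\mathbb{R}^2$, the variance of $\hat f_w$ is upper-bounded by the variance of the error: $$\mathrm{Var}\left[\hat f_w(X_1,X_2)\right]\le\sigma_\varepsilon^2.$$
   Context: B-splines. For a non-decreasing local knot vector $\mathbf{t}=[t_1,\dots,t_{p+2}]$, the B-spline $B[\mathbf{t}]:\mathbb{R}\to\mathbb{R}$ of degree $p$ is defined recursively by $$B[\mathbf{t}](x)=\frac{x-t_1}{t_{p+1}-t_1}B[t_1,\dots,t_{p+1}](x)+\frac{t_{p+2}-x}{t_{p+2}-t_2}B[t_2,\dots,t_{p+2}](x),$$ with $B[t_i,t_{i+1}](x)=1$ if $x\in[t_i,t_{i+1})$ and $0$ otherwise; terms with zero denominator are taken to be $0$ (convention $0/0=0$). For a global non-decreasing knot vector $\mathbf{t}=[t_1,\dots,t_{n+p+1}]$ put $\mathbf{t}^{(i)}=[t_i,\dots,t_{i+p+1}]$, $i=1,\dots,n$. Such a knot vector is $(p+1)$-regular if $n\ge p+1$, $t_1=t_{p+1}$,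 $t_{n+1}=t_{n+p+1}$, and $t_j<t_{j+p+1}$ for $j=1,\dots,n$. Let $p_1,p_2\ge1$ be integers and, for $k=1,2$, let $\mathbf{x}_k=[x_{k,1},\dots,x_{k,n_k+p_k+1}]$ be a $(p_k+1)$-regular knot vector. Tensor product B-splines are $B[\mathbf{x}_1^{(j_1)},\mathbf{x}_2^{(j_2)}](u_1,u_2)=B[\mathbf{x}_1^{(j_1)}](u_1)\,B[\mathbf{x}_2^{(j_2)}](u_2)$, and the knot averages are $\xi_k^{(j)}=(x_{k,j+1}+\dots+x_{k,j+p_k})/p_k$. Given (deterministic) weight functions $w_{\mathbf{u}}:\mathbb{R}^2\to[0,+\infty)$, $\mathbf{u}\in\mathbb{R}^2$, the wQISA estimator is $$\hat f_w(X_1,X_2)=\sum_{j_1=1}^{n_1}\sum_{j_2=1}^{n_2}\hat c_{j_1,j_2}\,B[\mathbf{x}_1^{(j_1)},\mathbf{x}_2^{(j_2)}](X_1,X_2),$$ $$\hat c_{j_1,j_2}=\frac{\sum_{i=1}^N Y_i\,w_{(\xi_1^{(j_1)},\xi_2^{(j_2)})}(X_{i,1},X_{i,2})}{\sum_{i=1}^N w_{(\xi_1^{(j_1)},\xi_2^{(j_2)})}(X_{i,1},X_{i,2})},$$ where all denominators are assumed to be positive. The variance is $\mathrm{Var}[\hat f_w(X_1,X_2)]=\mathbb{E}\left[\left(\hat f_w(X_1,X_2)-\mathbb{E}[\hat f_w(X_1,X_2)]\right)^2\right]$. *)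

theory Defs
  imports "HOL-Probability.Probability"
begin

text \<open>
  Knot vectors are functions on \<open>nat\<close> with one-based entries; an index range is always
  supplied by the degree \<open>p\<close> (and the dimension \<open>n\<close>), and entries outside it are irrelevant.
  Points of the plane are elements of \<open>real \<times> real\<close>.
\<close>

text \<open>
  The B-spline of degree \<open>p\<close> on the local knot vector \<open>[t 1, ..., t (p + 2)]\<close>.
  The convention that a term with zero denominator is zero is the convention \<open>a / 0 = 0\<close> of HOL.
\<close>

fun bspline :: "nat \<Rightarrow> (nat \<Rightarrow> real) \<Rightarrow> real \<Rightarrow> real" where
  "bspline 0 t x = (if t 1 \<le> x \<and> x < t 2 then 1 else 0)"
| "bspline (Suc p) t x =
     (x - t 1) / (t (p + 2) - t 1) * bspline p t x +
     (t (p + 3) - x) / (t (p + 3) - t 2) * bspline p (\<lambda>i. t (i + 1)) x"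

text \<open>\<open>local_knots t i\<close> is \<open>[t i, t (i + 1), ...]\<close>, re-indexed from one (for \<open>i \<ge> 1\<close>).\<close>

definition local_knots :: "(nat \<Rightarrow> real) \<Rightarrow> nat \<Rightarrow> nat \<Rightarrow> real" where
  "local_knots t i = (\<lambda>j. t (i + j - 1))"

text \<open>\<open>(p + 1)\<close>-regularity of the non-decreasing knot vector \<open>[t 1, ..., t (n + p + 1)]\<close>.\<close>

definition regular_knots :: "nat \<Rightarrow> nat \<Rightarrow> (nat \<Rightarrow> real) \<Rightarrow> bool" where
  "regular_knots p n t \<longleftrightarrow>
     mono_on {1..n + p + 1} t \<and> p + 1 \<le> n \<and>
     t 1 = t (p + 1) \<and> t (n + 1) = t (n + p + 1) \<and>
     (\<forall>j\<in>{1..n}. t j < t (j + p + 1))"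

definition tensor_bspline ::
    "nat \<Rightarrow> (nat \<Rightarrow> real) \<Rightarrow> nat \<Rightarrow> (nat \<Rightarrow> real) \<Rightarrow> real \<times> real \<Rightarrow> real" where
  "tensor_bspline p1 s1 p2 s2 u = bspline p1 s1 (fst u) * bspline p2 s2 (snd u)"

definition knot_average :: "nat \<Rightarrow> (nat \<Rightarrow> real) \<Rightarrow> nat \<Rightarrow> real" where
  "knot_average p t j = (\<Sum>l=1..p. t (j + l)) / real p"

text \<open>
  The coefficient attached to the weight centre \<open>u\<close>, for data sites \<open>X i\<close> and observed
  values \<open>y i\<close>, \<open>i = 1, ..., N\<close>.
\<close>

definition wqisa_coeff ::
    "nat \<Rightarrow> (nat \<Rightarrow> real \<times> real) \<Rightarrow> (nat \<Rightarrow> real) \<Rightarrow>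
     (real \<times> real \<Rightarrow> real \<times> real \<Rightarrow> real) \<Rightarrow> real \<times> real \<Rightarrow> real" where
  "wqisa_coeff N X y w u = (\<Sum>i=1..N. y i * w u (X i)) / (\<Sum>i=1..N. w u (X i))"

definition wqisa ::
    "nat \<Rightarrow> nat \<Rightarrow> (nat \<Rightarrow> real) \<Rightarrow> nat \<Rightarrow> nat \<Rightarrow> (nat \<Rightarrow> real) \<Rightarrow>
     (real \<times> real \<Rightarrow> real \<times> real \<Rightarrow> real) \<Rightarrow>
     nat \<Rightarrow> (nat \<Rightarrow> real \<times> real) \<Rightarrow> (nat \<Rightarrow> real) \<Rightarrow> real \<times> real \<Rightarrow> real" where
  "wqisa p1 n1 x1 p2 n2 x2 w N X y u =
     (\<Sum>j1=1..n1. \<Sum>j2=1..n2.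
        wqisa_coeff N X y w (knot_average p1 x1 j1, knot_average p2 x2 j2) *
        tensor_bspline p1 (local_knots x1 j1) p2 (local_knots x2 j2) u)"

end

theory Submission
  imports Defs
begin

text \<open>
  The estimator is linear in the observations, so at a fixed point \<open>u\<close> it is a combination
  \<open>\<Sum>i. a i * Y i\<close> with deterministic coefficients. Each coefficient attached to a weight
  centre is a weighted mean of the data, and B-splines are nonnegative and sum to at most one
  (to one on the half-open interval spanned by a regular knot vector, to zero elsewhere). Hence
  \<open>a i \<ge> 0\<close> and \<open>\<Sum>i. a i \<le> 1\<close>: the estimator is an averaging operator
  (\<open>wqisa_averaging\<close>).

  Averaging cannot increase the variance: centring every \<open>Y i\<close> centres the combination, and
  convexity of the square bounds the squared deviation of the combination, pointwise, by the same
  combination of the squared deviations (\<open>variance_subconvex_combination_le\<close>). Taking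
  expectations, the variance is at most \<open>(\<Sum>i. a i) * \<sigma>\<^sup>2 \<le> \<sigma>\<^sup>2\<close>.
\<close>

section \<open>Nonnegativity and subpartition of unity for B-splines\<close>

lemma bspline_eq_0_outside_support:
  assumes "mono_on {1..p + 2} t" and "x < t 1 \<or> t (p + 2) \<le> x"
  shows "bspline p t x = 0"
  using assms
proof (induction p arbitrary: t)
  case 0
  then show ?case by (auto simp: numeral_2_eq_2)
next
  case (Suc p)
  let ?s = "\<lambda>i. t (i + 1)"
  have mt: "mono_on {1..p + 2} t"
    using Suc.prems(1) by (rule mono_on_subset) auto
  have ms: "mono_on {1..p + 2} ?s"
    by (rule mono_onI, rule mono_onD[OF Suc.prems(1)]) auto
  have "t (p + 2) \<le> t (p + 3)" and "t 1 \<le> t 2"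
    by (rule mono_onD[OF Suc.prems(1)]; simp)+
  moreover have "x < t 1 \<or> t (p + 3) \<le> x"
    using Suc.prems(2) by (simp add: numeral_eq_Suc)
  ultimately have "x < t 1 \<or> t (p + 2) \<le> x" and "x < ?s 1 \<or> ?s (p + 2) \<le> x"
    by (auto simp: numeral_eq_Suc)
  then show ?case
    using Suc.IH[OF mt] Suc.IH[OF ms] by simp
qed

text \<open>
  The two weights with which a B-spline enters its two neighbours of the next degree are affine
  functions summing to one, with values in the unit interval on the support. Multiplying by the
  B-spline itself makes this true everywhere, also when coinciding end knots turn both weights into
  quotients by zero: then the support is empty.
\<close>

lemma cox_de_boor_weights:
  assumes "mono_on {1..p + 2} t" and "0 \<le> bspline p t x"
  shows "0 \<le> (x - t 1) / (t (p + 2) - t 1) * bspline p t x"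
    and "0 \<le> (t (p + 2) - x) / (t (p + 2) - t 1) * bspline p t x"
    and "(x - t 1) / (t (p + 2) - t 1) * bspline p t x +
         (t (p + 2) - x) / (t (p + 2) - t 1) * bspline p t x = bspline p t x"
proof -
  consider "bspline p t x = 0" | "t 1 \<le> x" "x < t (p + 2)"
    using bspline_eq_0_outside_support[OF assms(1)] by fastforce
  note cs = this
  show "0 \<le> (x - t 1) / (t (p + 2) - t 1) * bspline p t x"
    using cs by cases (use assms(2) in auto)
  show "0 \<le> (t (p + 2) - x) / (t (p + 2) - t 1) * bspline p t x"
    using cs by cases (use assms(2) in auto)
  show "(x - t 1) / (t (p + 2) - t 1) * bspline p t x +
        (t (p + 2) - x) / (t (p + 2) - t 1) * bspline p t x = bspline p t x"
    using cs
  proof cases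
    case 2
    then have "(x - t 1) / (t (p + 2) - t 1) + (t (p + 2) - x) / (t (p + 2) - t 1) = 1"
      by (simp flip: add_divide_distrib)
    then show ?thesis by (metis distrib_right mult_1)
  qed simp
qed

lemma bspline_nonneg:
  assumes "mono_on {1..p + 2} t"
  shows "0 \<le> bspline p t x"
  using assms
proof (induction p arbitrary: t)
  case 0
  then show ?case by simp
next
  case (Suc p)
  let ?s = "\<lambda>i. t (i + 1)"
  have mt: "mono_on {1..p + 2} t"
    using Suc.prems by (rule mono_on_subset) auto
  have ms: "mono_on {1..p + 2} ?s"
    by (rule mono_onI, rule mono_onD[OF Suc.prems]) auto
  have "bspline (Suc p) t x =
      (x - t 1) / (t (p + 2) - t 1) * bspline p t x +
      (?s (p + 2) - x) / (?s (p + 2) - ?s 1) * bspline p ?s x"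
    by (simp add: numeral_eq_Suc)
  then show ?case
    using cox_de_boor_weights(1)[OF mt Suc.IH[OF mt]]
      cox_de_boor_weights(2)[OF ms Suc.IH[OF ms]] by linarith
qed

lemma mono_on_local_knots:
  assumes "mono_on {1..m + p + 1} t" and "i \<in> {1..m}"
  shows "mono_on {1..p + 2} (local_knots t i)"
  unfolding local_knots_def
  by (rule mono_onI, rule mono_onD[OF assms(1)]) (use assms(2) in auto)

lemma sum_bspline_degree_0:
  assumes "mono_on {1..m + 1} t"
  shows "(\<Sum>i=1..m. bspline 0 (local_knots t i) x) =
         (if t 1 \<le> x \<and> x < t (m + 1) then 1 else 0)"
  using assms
proof (induction m)
  case 0
  then show ?case by simp
next
  case (Suc m)
  have "mono_on {1..m + 1} t"
    using Suc.prems by (rule mono_on_subset) auto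
  moreover have "t 1 \<le> t (m + 1)" and "t (m + 1) \<le> t (m + 2)"
    by (rule mono_onD[OF Suc.prems]; simp)+
  ultimately show ?case
    using Suc.IH by (auto simp: local_knots_def)
qed

text \<open>
  The sum of degree \<open>p + 1\<close> regroups by the B-splines of degree \<open>p\<close>. An interior one
  collects both of its weights, hence enters with total weight one. The first and the last collect
  only one of theirs, and completing these with the missing nonnegative terms gives the sum of
  degree \<open>p\<close> on the same knots, which has one more summand. This is why the bound, unlike the
  partition of unity itself, holds for all \<open>x\<close> and for any non-decreasing knots.
\<close>

lemma sum_bspline_le_1:
  assumes "mono_on {1..m + p + 1} t"
  shows "(\<Sum>i=1..m. bspline p (local_knots t i) x) \<le> 1"
  using assms
proof (induction p arbitrary: m)
  case 0
  then show ?case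
    using sum_bspline_degree_0[of m t x] by simp
next
  case (Suc p)
  let ?B = "\<lambda>i. bspline p (local_knots t i) x"
  define a where "a i = (x - local_knots t i 1) /
    (local_knots t i (p + 2) - local_knots t i 1) * ?B i" for i
  define b where "b i = (local_knots t i (p + 2) - x) /
    (local_knots t i (p + 2) - local_knots t i 1) * ?B i" for i
  have m: "mono_on {1..Suc m + p + 1} t"
    using Suc.prems by simp
  note weights = cox_de_boor_weights[OF mono_on_local_knots[OF m]
      bspline_nonneg[OF mono_on_local_knots[OF m]]]
  have pos: "0 \<le> a i" "0 \<le> b i" and total: "a i + b i = ?B i" if "i \<in> {1..Suc m}" for i
    unfolding a_def b_def using weights[OF that that] by auto
  have shift: "(\<lambda>j. local_knots t i (j + 1)) = local_knots t (Suc i)" for i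
    by (simp add: local_knots_def)
  have "bspline (Suc p) (local_knots t i) x = a i + b (Suc i)" for i
    unfolding bspline.simps shift a_def b_def
    by (simp add: local_knots_def numeral_eq_Suc)
  then have "(\<Sum>i=1..m. bspline (Suc p) (local_knots t i) x) =
      (\<Sum>i=1..m. a i) + (\<Sum>i=1..m. b (Suc i))"
    by (simp add: sum.distrib)
  also have "(\<Sum>i=1..m. b (Suc i)) = (\<Sum>i=Suc 1..Suc m. b i)"
    by (rule sum.shift_bounds_cl_Suc_ivl[symmetric])
  also have "(\<Sum>i=1..m. a i) + (\<Sum>i=Suc 1..Suc m. b i) \<le>
      (\<Sum>i=1..Suc m. a i) + (\<Sum>i=1..Suc m. b i)"
    by (intro add_mono sum_mono2) (auto intro!: pos)
  also have "\<dots> = (\<Sum>i=1..Suc m. ?B i)"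
    unfolding sum.distrib[symmetric] using total by (intro sum.cong) auto
  also have "\<dots> \<le> 1"
    using Suc.IH[OF m] .
  finally show ?case .
qed

section \<open>The estimator as an averaging operator\<close>

definition wqisa_influence ::
    "nat \<Rightarrow> nat \<Rightarrow> (nat \<Rightarrow> real) \<Rightarrow> nat \<Rightarrow> nat \<Rightarrow> (nat \<Rightarrow> real) \<Rightarrow>
     (real \<times> real \<Rightarrow> real \<times> real \<Rightarrow> real) \<Rightarrow>
     nat \<Rightarrow> (nat \<Rightarrow> real \<times> real) \<Rightarrow> real \<times> real \<Rightarrow> nat \<Rightarrow> real" where
  "wqisa_influence p1 n1 x1 p2 n2 x2 w N X u i =
     (\<Sum>j1=1..n1. \<Sum>j2=1..n2.
        w (knot_average p1 x1 j1, knot_average p2 x2 j2) (X i) /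
        (\<Sum>k=1..N. w (knot_average p1 x1 j1, knot_average p2 x2 j2) (X k)) *
        tensor_bspline p1 (local_knots x1 j1) p2 (local_knots x2 j2) u)"

lemma wqisa_eq_sum_influence:
  "wqisa p1 n1 x1 p2 n2 x2 w N X y u =
   (\<Sum>i=1..N. wqisa_influence p1 n1 x1 p2 n2 x2 w N X u i * y i)"
proof -
  let ?c = "\<lambda>j1 j2. (knot_average p1 x1 j1, knot_average p2 x2 j2)"
  let ?T = "\<lambda>j1 j2. tensor_bspline p1 (local_knots x1 j1) p2 (local_knots x2 j2) u"
  let ?g = "\<lambda>i j1 j2. w (?c j1 j2) (X i) / (\<Sum>k=1..N. w (?c j1 j2) (X k)) * ?T j1 j2 * y i"
  have "wqisa p1 n1 x1 p2 n2 x2 w N X y u = (\<Sum>j1=1..n1. \<Sum>j2=1..n2. \<Sum>i=1..N. ?g i j1 j2)"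
    unfolding wqisa_def wqisa_coeff_def sum_divide_distrib sum_distrib_right
    by (intro sum.cong refl) (simp add: mult_ac)
  also have "\<dots> = (\<Sum>j1=1..n1. \<Sum>i=1..N. \<Sum>j2=1..n2. ?g i j1 j2)"
    by (intro sum.cong refl sum.swap)
  also have "\<dots> = (\<Sum>i=1..N. \<Sum>j1=1..n1. \<Sum>j2=1..n2. ?g i j1 j2)"
    by (rule sum.swap)
  finally show ?thesis
    unfolding wqisa_influence_def sum_distrib_right .
qed

text \<open>
  Every coefficient of the estimator reproduces constants, so the total influence of the data is
  the value of the estimator on the constant \<open>1\<close>, that is, the sum of all tensor products; this
  sum factors into the two univariate ones.
\<close>

lemma wqisa_averaging:
  assumes m1: "mono_on {1..n1 + p1 + 1} x1" and m2: "mono_on {1..n2 + p2 + 1} x2"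
    and w: "\<And>v z. 0 \<le> w v z"
    and pos: "\<And>j1 j2. j1 \<in> {1..n1} \<Longrightarrow> j2 \<in> {1..n2} \<Longrightarrow>
           (\<Sum>i=1..N. w (knot_average p1 x1 j1, knot_average p2 x2 j2) (X i)) > 0"
  shows "0 \<le> wqisa_influence p1 n1 x1 p2 n2 x2 w N X u i"
    and "(\<Sum>i=1..N. wqisa_influence p1 n1 x1 p2 n2 x2 w N X u i) \<le> 1"
proof -
  let ?B1 = "\<lambda>j. bspline p1 (local_knots x1 j) (fst u)"
  let ?B2 = "\<lambda>j. bspline p2 (local_knots x2 j) (snd u)"
  have B1: "0 \<le> ?B1 j" if "j \<in> {1..n1}" for j
    by (intro bspline_nonneg mono_on_local_knots[OF m1 that])
  have B2: "0 \<le> ?B2 j" if "j \<in> {1..n2}" for j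
    by (intro bspline_nonneg mono_on_local_knots[OF m2 that])
  show "0 \<le> wqisa_influence p1 n1 x1 p2 n2 x2 w N X u i"
    unfolding wqisa_influence_def tensor_bspline_def
    by (intro sum_nonneg mult_nonneg_nonneg divide_nonneg_nonneg w B1 B2)
  have "(\<Sum>i=1..N. wqisa_influence p1 n1 x1 p2 n2 x2 w N X u i) =
      wqisa p1 n1 x1 p2 n2 x2 w N X (\<lambda>_. 1) u"
    by (simp add: wqisa_eq_sum_influence)
  also have "\<dots> = (\<Sum>j1=1..n1. \<Sum>j2=1..n2. ?B1 j1 * ?B2 j2)"
    unfolding wqisa_def wqisa_coeff_def tensor_bspline_def
    using pos by (intro sum.cong refl) (simp add: less_imp_neq[THEN not_sym])
  also have "\<dots> = (\<Sum>j=1..n1. ?B1 j) * (\<Sum>j=1..n2. ?B2 j)"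
    by (simp add: sum_product)
  also have "\<dots> \<le> 1"
    using sum_bspline_le_1[OF m1] sum_bspline_le_1[OF m2] B1 B2
    by (intro mult_le_one sum_nonneg) auto
  finally show "(\<Sum>i=1..N. wqisa_influence p1 n1 x1 p2 n2 x2 w N X u i) \<le> 1" .
qed

section \<open>Averaging does not increase the variance\<close>

lemma square_subconvex_combination_le:
  fixes a z :: "'b \<Rightarrow> real"
  assumes a: "\<And>i. i \<in> I \<Longrightarrow> 0 \<le> a i" and le1: "(\<Sum>i\<in>I. a i) \<le> 1"
  shows "(\<Sum>i\<in>I. a i * z i)\<^sup>2 \<le> (\<Sum>i\<in>I. a i * (z i)\<^sup>2)"
proof -
  \<comment> \<open>With each coefficient split into two square roots, this is the Cauchy-Schwarz inequality.\<close>
  have "(\<Sum>i\<in>I. a i * z i)\<^sup>2 = (\<Sum>i\<in>I. sqrt (a i) * (sqrt (a i) * z i))\<^sup>2"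
    using a by (intro arg_cong[where f = "\<lambda>s. s\<^sup>2"] sum.cong) (auto simp flip: mult.assoc)
  also have "\<dots> \<le> (\<Sum>i\<in>I. (sqrt (a i))\<^sup>2) * (\<Sum>i\<in>I. (sqrt (a i) * z i)\<^sup>2)"
    by (rule Cauchy_Schwarz_ineq_sum)
  also have "\<dots> = (\<Sum>i\<in>I. a i) * (\<Sum>i\<in>I. a i * (z i)\<^sup>2)"
    using a by (simp add: power_mult_distrib)
  also have "\<dots> \<le> 1 * (\<Sum>i\<in>I. a i * (z i)\<^sup>2)"
    using a by (intro mult_right_mono le1 sum_nonneg) auto
  finally show ?thesis by simp
qed

lemma (in prob_space) variance_subconvex_combination_le:
  fixes Z :: "'b \<Rightarrow> 'a \<Rightarrow> real"
  assumes a: "\<And>i. i \<in> I \<Longrightarrow> 0 \<le> a i" and le1: "(\<Sum>i\<in>I. a i) \<le> 1" and v: "0 \<le> v"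
    and int: "\<And>i. i \<in> I \<Longrightarrow> integrable M (Z i)"
    and int2: "\<And>i. i \<in> I \<Longrightarrow> integrable M (\<lambda>\<omega>. (Z i \<omega> - expectation (Z i))\<^sup>2)"
    and var: "\<And>i. i \<in> I \<Longrightarrow> variance (Z i) \<le> v"
  shows "variance (\<lambda>\<omega>. \<Sum>i\<in>I. a i * Z i \<omega>) \<le> v"
proof -
  have mean: "expectation (\<lambda>\<omega>. \<Sum>i\<in>I. a i * Z i \<omega>) = (\<Sum>i\<in>I. a i * expectation (Z i))"
    using int by simp
  have "variance (\<lambda>\<omega>. \<Sum>i\<in>I. a i * Z i \<omega>) =
      expectation (\<lambda>\<omega>. (\<Sum>i\<in>I. a i * (Z i \<omega> - expectation (Z i)))\<^sup>2)"
    unfolding mean by (simp add: right_diff_distrib sum_subtractf)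
  also have "\<dots> \<le> expectation (\<lambda>\<omega>. \<Sum>i\<in>I. a i * (Z i \<omega> - expectation (Z i))\<^sup>2)"
    using a le1 int2
    by (intro integral_mono' square_subconvex_combination_le sum_nonneg) auto
  also have "\<dots> = (\<Sum>i\<in>I. a i * variance (Z i))"
    using int2 by simp
  also have "\<dots> \<le> (\<Sum>i\<in>I. a i * v)"
    using a var by (intro sum_mono mult_left_mono) auto
  also have "\<dots> = (\<Sum>i\<in>I. a i) * v"
    by (simp add: sum_distrib_right)
  also have "\<dots> \<le> v"
    using mult_right_mono[OF le1 v] by simp
  finally show ?thesis .
qed

section \<open>The variance bound\<close>

theorem lemma3p1:
  fixes M :: "'a measure"
    and f :: "real \<times> real \<Rightarrow> real"
    and N :: nat
    and X :: "nat \<Rightarrow> real \<times> real"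
    and \<epsilon> Y :: "nat \<Rightarrow> 'a \<Rightarrow> real"
    and \<sigma> :: real
    and p1 p2 n1 n2 :: nat
    and x1 x2 :: "nat \<Rightarrow> real"
    and w :: "real \<times> real \<Rightarrow> real \<times> real \<Rightarrow> real"
    and u :: "real \<times> real"
  assumes "prob_space M"
    and "p1 \<ge> 1" and "p2 \<ge> 1"
    and "regular_knots p1 n1 x1" and "regular_knots p2 n2 x2"
    and "\<And>v z. w v z \<ge> 0"
    and "\<And>j1 j2. j1 \<in> {1..n1} \<Longrightarrow> j2 \<in> {1..n2} \<Longrightarrow>
           (\<Sum>i=1..N. w (knot_average p1 x1 j1, knot_average p2 x2 j2) (X i)) > 0"
    and "prob_space.indep_vars M (\<lambda>_. borel) \<epsilon> {1..N}"
    and "\<And>i j. i \<in> {1..N} \<Longrightarrow> j \<in> {1..N} \<Longrightarrow> distr M borel (\<epsilon> i) = distr M borel (\<epsilon> j)"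
    and "\<And>i. i \<in> {1..N} \<Longrightarrow> integrable M (\<epsilon> i)"
    and "\<And>i. i \<in> {1..N} \<Longrightarrow> integrable M (\<lambda>\<omega>. (\<epsilon> i \<omega>)\<^sup>2)"
    and "\<And>i. i \<in> {1..N} \<Longrightarrow> prob_space.expectation M (\<epsilon> i) = 0"
    and "\<And>i. i \<in> {1..N} \<Longrightarrow> prob_space.variance M (\<epsilon> i) = \<sigma>\<^sup>2"
    and "\<And>i \<omega>. i \<in> {1..N} \<Longrightarrow> \<omega> \<in> space M \<Longrightarrow> Y i \<omega> = f (X i) + \<epsilon> i \<omega>"
  shows "prob_space.variance M
           (\<lambda>\<omega>. wqisa p1 n1 x1 p2 n2 x2 w N X (\<lambda>i. Y i \<omega>) u) \<le> \<sigma>\<^sup>2"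
proof -
  interpret prob_space M by fact
  let ?a = "wqisa_influence p1 n1 x1 p2 n2 x2 w N X u"
  have m1: "mono_on {1..n1 + p1 + 1} x1" and m2: "mono_on {1..n2 + p2 + 1} x2"
    using assms(4,5) by (auto simp: regular_knots_def)
  have intY: "integrable M (Y i)" and meanY: "expectation (Y i) = f (X i)"
    if i: "i \<in> {1..N}" for i
  proof -
    have "integrable M (Y i) \<longleftrightarrow> integrable M (\<lambda>\<omega>. f (X i) + \<epsilon> i \<omega>)"
      using assms(14)[OF i] by (intro Bochner_Integration.integrable_cong) auto
    then show "integrable M (Y i)"
      using assms(10)[OF i] by simp
    have "expectation (Y i) = expectation (\<lambda>\<omega>. f (X i) + \<epsilon> i \<omega>)"
      using assms(14)[OF i] by (intro Bochner_Integration.integral_cong) auto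
    then show "expectation (Y i) = f (X i)"
      using assms(10,12)[OF i] by (simp add: prob_space)
  qed
  have dev: "(Y i \<omega> - expectation (Y i))\<^sup>2 = (\<epsilon> i \<omega>)\<^sup>2"
    if "i \<in> {1..N}" "\<omega> \<in> space M" for i \<omega>
    using assms(14)[OF that] meanY[OF that(1)] by simp
  have sqY: "integrable M (\<lambda>\<omega>. (Y i \<omega> - expectation (Y i))\<^sup>2)" if i: "i \<in> {1..N}" for i
  proof -
    have "integrable M (\<lambda>\<omega>. (Y i \<omega> - expectation (Y i))\<^sup>2) \<longleftrightarrow> integrable M (\<lambda>\<omega>. (\<epsilon> i \<omega>)\<^sup>2)"
      using dev[OF i] by (intro Bochner_Integration.integrable_cong) auto
    then show ?thesis
      using assms(11)[OF i] by simp
  qed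
  have varY: "variance (Y i) \<le> \<sigma>\<^sup>2" if i: "i \<in> {1..N}" for i
  proof -
    have "variance (Y i) = expectation (\<lambda>\<omega>. (\<epsilon> i \<omega>)\<^sup>2)"
      using dev[OF i] by (intro Bochner_Integration.integral_cong) auto
    also have "\<dots> = \<sigma>\<^sup>2"
      using assms(13)[OF i] assms(12)[OF i] by simp
    finally show ?thesis by simp
  qed
  show ?thesis
    unfolding wqisa_eq_sum_influence
    using wqisa_averaging[where w = w and X = X and N = N, OF m1 m2 assms(6,7)] intY sqY varY
    by (intro variance_subconvex_combination_le) auto
qed

end
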